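(* Let $k$ be a field, let $G$ be a finite simple graph with vertex set $\{x_1,\dots,x_m\}$ and edge ideal $I=I(G)\subset k[x_1,\dots,x_m]$, let $\alpha=(\alpha_1,\dots,\alpha_m)\in(\mathbb Z^+)^m$, let $I_\alpha=I(G^\alpha)$ be the edge ideal of the parallelization $G^\alpha$, and let $s\ge 1$ be an integer. Then $$\mathcal G(I_\alpha^{(s)})=\Big\{\prod_{i=1}^m\prod_{j=1}^{\alpha_i}x_{i,j}^{e_{i,j}} : e_{i,j}\in\mathbb Z_{\ge0},\ \sum_{j=1}^{\alpha_i}e_{i,j}=a_i\ (1\le i\le m)\ \text{for some } x_1^{a_1}\cdots x_m^{a_m}\in\mathcal G(I^{(s)})\Big\}.$$
   Context: The edge ideal of a finite simple graph is the ideal generated by the products $xy$ over all edges $\{x,y\}$, in the polynomial ring over $k$ whose variables are the vertices. Parallelization: for $G$ with vertex set $\{x_1,\dots,x_m\}$ and $\alpha\in(\mathbb Z^+)^m$, $G^\alpha$ is the graph with vertex set $\{x_{i,t}: 1\le i\le m,\ 1\le t\le\alpha_i\}$ and edge set $\{\{x_{i,t},x_{j,\ell}\} : \{x_i,x_j\}\in E(G)\}$. Symbolic powers: for a monomial ideal $I$ with primary decomposition $I=I_1\cap\dots\cap I_n$, and $Q$ an associated prime of $I$ maximal under inclusion, put $I_{\subseteq Q}=\bigcap_{\sqrt{I_\ell}\subseteq Q}I_\ell$; then $I^{(s)}=\bigcap_{Q}I_{\subseteq Q}^s$, the intersection running over all associated primes $Q$ of $I$ that are maximal with respect to inclusion.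 $\mathcal G(I)$ denotes the (unique) set of minimal monomial generators of a monomial ideal $I$. *)

theory Defs
  imports "HOL-Algebra.Ideal_Product" "HOL-Library.Poly_Mapping"
begin

section \<open>Simple graphs, parallelization\<close>

record 'v ugraph =
  verts :: "'v set"
  edges :: "'v set set"

definition simple_graph :: "'v ugraph \<Rightarrow> bool" where
  "simple_graph G \<longleftrightarrow> finite (verts G) \<and> (\<forall>e\<in>edges G. e \<subseteq> verts G \<and> card e = 2)"

text \<open>The copy $x_{i,t}$ of the vertex $x_i$ is the pair \<open>(i, t)\<close>, with \<open>t\<close> counted from 1.\<close>

definition parallelization :: "'v ugraph \<Rightarrow> ('v \<Rightarrow> nat) \<Rightarrow> ('v \<times> nat) ugraph" where
  "parallelization G \<alpha> =
     \<lparr> verts = {(x, t). x \<in> verts G \<and> 1 \<le> t \<and> t \<le> \<alpha> x},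
       edges = {{(x, t), (y, l)} | x t y l.
                  {x, y} \<in> edges G \<and> 1 \<le> t \<and> t \<le> \<alpha> x \<and> 1 \<le> l \<and> l \<le> \<alpha> y} \<rparr>"

lemma simple_graph_parallelization:
  assumes "simple_graph G"
  shows "simple_graph (parallelization G \<alpha>)"
proof -
  have "verts (parallelization G \<alpha>) = (SIGMA x:verts G. {1..\<alpha> x})"
    by (auto simp: parallelization_def)
  moreover have "finite (verts G)"
    using assms by (simp add: simple_graph_def)
  ultimately have "finite (verts (parallelization G \<alpha>))"
    by simp
  moreover have "e \<subseteq> verts (parallelization G \<alpha>) \<and> card e = 2"
    if e: "e \<in> edges (parallelization G \<alpha>)" for e
  proof -
    obtain x t y l where *: "e = {(x, t), (y, l)}" "{x, y} \<in> edges G"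
        "1 \<le> t" "t \<le> \<alpha> x" "1 \<le> l" "l \<le> \<alpha> y"
      using e by (auto simp: parallelization_def)
    have xy: "{x, y} \<subseteq> verts G" "card {x, y} = 2"
      using assms *(2) by (auto simp: simple_graph_def)
    then have "x \<noteq> y"
      by auto
    then show ?thesis
      using * xy by (auto simp: parallelization_def)
  qed
  ultimately show ?thesis
    by (simp add: simple_graph_def)
qed


section \<open>Polynomial rings\<close>

text \<open>
  A polynomial maps exponent vectors (finitely supported functions from variables to naturals) to
  coefficients. The ring $k[V]$ consists of the polynomials in which only variables of \<open>V\<close> occur.
\<close>

type_synonym ('v, 'k) mpoly = "('v \<Rightarrow>\<^sub>0 nat) \<Rightarrow>\<^sub>0 'k"

definition mvar :: "'v \<Rightarrow> ('v, 'k::comm_ring_1) mpoly" where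
  "mvar x = Poly_Mapping.single (Poly_Mapping.single x 1) 1"

definition monomials :: "'v set \<Rightarrow> ('v, 'k::comm_ring_1) mpoly set" where
  "monomials V = {Poly_Mapping.single t 1 | t. Poly_Mapping.keys t \<subseteq> V}"

definition poly_ring :: "'v set \<Rightarrow> ('v, 'k::comm_ring_1) mpoly ring" where
  "poly_ring V = \<lparr> carrier = {p. \<forall>t\<in>Poly_Mapping.keys p. Poly_Mapping.keys t \<subseteq> V},
                   mult = (*), one = 1, zero = 0, add = (+) \<rparr>"

lemma cring_poly_ring: "cring (poly_ring V)"
proof (rule cringI)
  show "abelian_group (poly_ring V :: ('a, 'b) mpoly ring)"
  proof (rule abelian_groupI)
    fix p q :: "('a, 'b) mpoly"
    assume "p \<in> carrier (poly_ring V)" "q \<in> carrier (poly_ring V)"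
    then show "p \<oplus>\<^bsub>poly_ring V\<^esub> q \<in> carrier (poly_ring V)"
      using Poly_Mapping.keys_add[of p q] by (auto simp: poly_ring_def)
  next
    fix p :: "('a, 'b) mpoly"
    assume "p \<in> carrier (poly_ring V)"
    then show "\<exists>q\<in>carrier (poly_ring V). q \<oplus>\<^bsub>poly_ring V\<^esub> p = \<zero>\<^bsub>poly_ring V\<^esub>"
      by (intro bexI[of _ "- p"]) (auto simp: poly_ring_def in_keys_iff)
  qed (auto simp: poly_ring_def algebra_simps)
next
  show "comm_monoid (poly_ring V :: ('a, 'b) mpoly ring)"
  proof (rule comm_monoidI)
    fix p q :: "('a, 'b) mpoly"
    assume *: "p \<in> carrier (poly_ring V)" "q \<in> carrier (poly_ring V)"
    have "Poly_Mapping.keys t \<subseteq> V" if t: "t \<in> Poly_Mapping.keys (p * q)" for t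
    proof -
      obtain a b where "a \<in> Poly_Mapping.keys p" "b \<in> Poly_Mapping.keys q" "t = a + b"
        using t Poly_Mapping.keys_mult[of p q] by auto
      then show ?thesis
        using * Poly_Mapping.keys_add[of a b] by (force simp: poly_ring_def)
    qed
    then show "p \<otimes>\<^bsub>poly_ring V\<^esub> q \<in> carrier (poly_ring V)"
      by (auto simp: poly_ring_def)
  qed (auto simp: poly_ring_def algebra_simps)
qed (auto simp: poly_ring_def algebra_simps)

definition edge_ideal :: "'v ugraph \<Rightarrow> ('v, 'k::comm_ring_1) mpoly set" where
  "edge_ideal G = Idl\<^bsub>poly_ring (verts G)\<^esub> {mvar x * mvar y | x y. {x, y} \<in> edges G}"

definition is_min_monomial_gens ::
    "'v set \<Rightarrow> ('v, 'k::comm_ring_1) mpoly set \<Rightarrow> ('v, 'k) mpoly set \<Rightarrow> bool" where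
  "is_min_monomial_gens V I A \<longleftrightarrow>
     A \<subseteq> monomials V \<and> Idl\<^bsub>poly_ring V\<^esub> A = I \<and> (\<forall>B. B \<subset> A \<longrightarrow> Idl\<^bsub>poly_ring V\<^esub> B \<noteq> I)"

text \<open>Meaningful for monomial ideals \<open>I\<close> of $k[V]$, which have exactly one such set.\<close>

definition min_monomial_gens ::
    "'v set \<Rightarrow> ('v, 'k::comm_ring_1) mpoly set \<Rightarrow> ('v, 'k) mpoly set" where
  "min_monomial_gens V I = (THE A. is_min_monomial_gens V I A)"


section \<open>Symbolic powers\<close>

definition radical :: "('a, 'b) ring_scheme \<Rightarrow> 'a set \<Rightarrow> 'a set" where
  "radical R I = {a \<in> carrier R. \<exists>n::nat. a [^]\<^bsub>R\<^esub> n \<in> I}"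

definition primary_ideal :: "('a, 'b) ring_scheme \<Rightarrow> 'a set \<Rightarrow> bool" where
  "primary_ideal R I \<longleftrightarrow> ideal I R \<and> I \<noteq> carrier R \<and>
     (\<forall>a\<in>carrier R. \<forall>b\<in>carrier R. a \<otimes>\<^bsub>R\<^esub> b \<in> I \<longrightarrow> a \<in> I \<or> b \<in> radical R I)"

definition primary_decomposition :: "('a, 'b) ring_scheme \<Rightarrow> 'a set \<Rightarrow> 'a set set \<Rightarrow> bool" where
  "primary_decomposition R I D \<longleftrightarrow>
     finite D \<and> (\<forall>J\<in>D. primary_ideal R J) \<and> I = carrier R \<inter> \<Inter>D"

text \<open>The primes of the form $(I : f)$.\<close>

definition associated_primes :: "('a, 'b) ring_scheme \<Rightarrow> 'a set \<Rightarrow> 'a set set" where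
  "associated_primes R I =
     {Q. primeideal Q R \<and> (\<exists>f\<in>carrier R. Q = {g \<in> carrier R. f \<otimes>\<^bsub>R\<^esub> g \<in> I})}"

definition max_associated_primes :: "('a, 'b) ring_scheme \<Rightarrow> 'a set \<Rightarrow> 'a set set" where
  "max_associated_primes R I =
     {Q \<in> associated_primes R I. \<forall>Q'\<in>associated_primes R I. Q \<subseteq> Q' \<longrightarrow> Q' = Q}"

text \<open>
  With respect to a primary decomposition \<open>D\<close> of the ideal,
  \<open>sub_component R D Q\<close> is $I_{\subseteq Q}$.
\<close>

definition sub_component :: "('a, 'b) ring_scheme \<Rightarrow> 'a set set \<Rightarrow> 'a set \<Rightarrow> 'a set" where
  "sub_component R D Q = carrier R \<inter> \<Inter>{J \<in> D. radical R J \<subseteq> Q}"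

text \<open>
  The choice of the primary decomposition is immaterial: for every decomposition of \<open>I\<close>, whether
  irredundant or not, $I_{\subseteq Q}$ is the contraction to \<open>R\<close> of the localization $I_Q$.
  Powers of ideals are taken in the semiring \<^const>\<open>ideals_set\<close> of all ideals of \<open>R\<close>.
\<close>

definition symbolic_power :: "('a, 'b) ring_scheme \<Rightarrow> 'a set \<Rightarrow> nat \<Rightarrow> 'a set" where
  "symbolic_power R I s =
     (let D = (SOME D. primary_decomposition R I D)
      in carrier R \<inter>
         (\<Inter>Q\<in>max_associated_primes R I. sub_component R D Q [^]\<^bsub>ideals_set R\<^esub> s))"

end

theory Submission
  imports Defs "HOL-Library.Product_Lexorder"
begin

text \<open>
  The edge ideal of a graph is the intersection of the primes $P_C$ generated by its minimal vertex
  covers \<open>C\<close>: a squarefree monomial contains an edge if and only if its support meets every minimal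
  cover (\<open>contains_edge_iff_meets_covers\<close>). For an ideal that is a finite intersection of pairwise
  incomparable primes, these primes are exactly the associated ones, all of them maximal, and the
  component of the ideal at each prime is that prime, whatever primary decomposition is chosen. Hence
  the symbolic power is the intersection of the powers of the primes
  (\<open>symbolic_power_inter_primes\<close>).

  A polynomial lies in $P_C^s$ if and only if each of its monomials has degree at least \<open>s\<close> in the
  variables of \<open>C\<close> (\<open>weight_ideal_power\<close>). So $I(G)^{(s)}$ is the monomial ideal whose monomials
  have degree at least \<open>s\<close> on every vertex cover (\<open>symbolic_power_edge_ideal\<close>), and its minimal
  generators are the monomials that are minimal under divisibility with this property
  (\<open>min_monomial_gens_symbolic_power\<close>).

  For the parallelization, call collapsing the substitution of $x_i$ for all copies $x_{i,t}$. The
  copies of a cover of \<open>G\<close> form a cover of $G^\alpha$, and each cover of $G^\alpha$ contains one of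
  this kind. Therefore a monomial lies in the symbolic power of the parallelization if and only if the
  collapsed monomial lies in that of \<open>G\<close> (\<open>symbolic_exps_parallelization\<close>). Dividing by one copy of
  $x_i$ corresponds to dividing the collapsed monomial by $x_i$, so minimality is preserved in both
  directions as well (\<open>min_exps_parallelization\<close>). The generators for $G^\alpha$ are thus the monomials
  that collapse to generators for \<open>G\<close>, which is the claim.
\<close>


section \<open>Symbolic powers of finite intersections of primes\<close>

text \<open>
  Multiply one witness from each ideal \<open>J\<close>: the product lies in every \<open>J\<close>, and it avoids \<open>Q\<close> because
  the complement of a prime is multiplicatively closed. Such elements serve to realise a prime as a
  colon ideal and to clear the components that the localization at \<open>Q\<close> does not see.
\<close>

lemma (in cring) finite_inter_not_subset_prime:
  assumes Q: "primeideal Q R" and "finite K"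
    and "\<And>J. J \<in> K \<Longrightarrow> ideal J R" and "\<And>J. J \<in> K \<Longrightarrow> \<not> J \<subseteq> Q"
  shows "\<exists>f \<in> carrier R. f \<notin> Q \<and> (\<forall>J\<in>K. f \<in> J)"
  using assms(2-)
proof (induction K rule: finite_induct)
  case empty
  then show ?case
    using Q ideal.one_imp_carrier[OF primeideal.axioms(1)[OF Q]] primeideal.I_notcarr[OF Q] by auto
next
  case (insert J K)
  obtain f where f: "f \<in> carrier R" "f \<notin> Q" "\<forall>J\<in>K. f \<in> J"
    using insert by auto
  obtain g where g: "g \<in> J" "g \<notin> Q"
    using insert.prems(2)[of J] by auto
  have gR: "g \<in> carrier R"
    by (rule ideal.Icarr[OF insert.prems(1) g(1)]) simp
  have "f \<otimes> g \<notin> Q"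
    using primeideal.I_prime[OF Q f(1) gR] f g by auto
  moreover have "f \<otimes> g \<in> J"
    by (rule ideal.I_l_closed[OF insert.prems(1) g(1) f(1)]) simp
  moreover have "\<forall>L\<in>K. f \<otimes> g \<in> L"
    using ideal.I_r_closed[OF insert.prems(1) _ gR] f(3) by simp
  ultimately show ?case
    using f(1) gR by auto
qed

lemma (in cring) prime_power_mem:
  assumes "primeideal Q R" "a \<in> carrier R" "a [^] (n::nat) \<in> Q"
  shows "a \<in> Q"
  using assms(3)
proof (induction n)
  case 0
  then show ?case
    using ideal.one_imp_carrier[OF primeideal.axioms(1)[OF assms(1)]] assms(2) by auto
next
  case (Suc n)
  then show ?case
    using primeideal.I_prime[OF assms(1), of "a [^] n" a] assms(2) by auto
qed

lemma (in cring) radical_subset_prime: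
  assumes "primeideal Q R" "J \<subseteq> Q"
  shows "radical R J \<subseteq> Q"
  using prime_power_mem[OF assms(1)] assms(2) by (auto simp: radical_def)

lemma (in cring) prime_imp_primary:
  assumes "primeideal Q R"
  shows "primary_ideal R Q"
  unfolding primary_ideal_def
proof (intro conjI ballI impI)
  show "ideal Q R" "Q \<noteq> carrier R"
    using primeideal.axioms(1)[OF assms] primeideal.I_notcarr[OF assms] by auto
  fix a b assume ab: "a \<in> carrier R" "b \<in> carrier R" "a \<otimes> b \<in> Q"
  moreover have "b \<in> radical R Q" if "b \<in> Q"
    using that ab(2) by (auto simp: radical_def intro!: exI[of _ "Suc 0"])
  ultimately show "a \<in> Q \<or> b \<in> radical R Q"
    using primeideal.I_prime[OF assms ab] by auto
qed

text \<open>
  A colon ideal of an intersection of primes is again an intersection of some of them,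
  \<open>(I : f) = \<Inter>{P \<in> F. f \<notin> P}\<close>. If it is prime, it contains one of its members and so equals it.
  Conversely \<open>P\<close> arises from an \<open>f\<close> outside \<open>P\<close> that lies in all the other primes, which exists
  because none of them is contained in \<open>P\<close>.
\<close>

lemma (in cring) associated_primes_inter_primes:
  assumes F: "finite F" "\<And>P. P \<in> F \<Longrightarrow> primeideal P R"
    and antichain: "\<And>P Q. P \<in> F \<Longrightarrow> Q \<in> F \<Longrightarrow> P \<subseteq> Q \<Longrightarrow> P = Q"
    and I: "I = carrier R \<inter> \<Inter>F"
  shows "associated_primes R I = F"
proof -
  have ideal: "ideal P R" if "P \<in> F" for P
    by (rule primeideal.axioms(1)[OF F(2)[OF that]])
  have colon: "f \<otimes> g \<in> I \<longleftrightarrow> (\<forall>P\<in>F. f \<notin> P \<longrightarrow> g \<in> P)"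
    if "f \<in> carrier R" "g \<in> carrier R" for f g
  proof -
    have "f \<otimes> g \<in> P \<longleftrightarrow> f \<in> P \<or> g \<in> P" if P: "P \<in> F" for P
    proof
      show "f \<in> P \<or> g \<in> P" if "f \<otimes> g \<in> P"
        by (rule primeideal.I_prime[OF F(2)[OF P] \<open>f \<in> carrier R\<close> \<open>g \<in> carrier R\<close> that])
      show "f \<otimes> g \<in> P" if "f \<in> P \<or> g \<in> P"
        using that ideal.I_r_closed[OF ideal[OF P] _ \<open>g \<in> carrier R\<close>]
          ideal.I_l_closed[OF ideal[OF P] _ \<open>f \<in> carrier R\<close>] by auto
    qed
    then show ?thesis
      using that by (auto simp: I)
  qed
  show ?thesis
  proof (intro Set.set_eqI iffI)
    fix Q assume "Q \<in> associated_primes R I"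
    then obtain f where Q: "primeideal Q R" "f \<in> carrier R" "Q = {g \<in> carrier R. f \<otimes> g \<in> I}"
      by (auto simp: associated_primes_def)
    let ?K = "{P \<in> F. f \<notin> P}"
    have Q_eq: "Q = {g \<in> carrier R. \<forall>P\<in>?K. g \<in> P}"
      using Q(2) colon unfolding Q(3) by auto
    have "\<exists>P\<in>?K. P \<subseteq> Q"
    proof (rule ccontr)
      assume "\<not> (\<exists>P\<in>?K. P \<subseteq> Q)"
      then obtain g where "g \<in> carrier R" "g \<notin> Q" "\<forall>P\<in>?K. g \<in> P"
        using finite_inter_not_subset_prime[OF Q(1), of ?K] F(1) ideal by auto
      then show False
        using Q_eq by blast
    qed
    then obtain P where "P \<in> ?K" "P \<subseteq> Q"
      by blast
    moreover have "Q \<subseteq> P"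
      using Q_eq \<open>P \<in> ?K\<close> by blast
    ultimately show "Q \<in> F"
      by auto
  next
    fix P assume P: "P \<in> F"
    have "\<exists>f \<in> carrier R. f \<notin> P \<and> (\<forall>J\<in>F - {P}. f \<in> J)"
      by (rule finite_inter_not_subset_prime) (use F ideal P antichain in auto)
    then obtain f where f: "f \<in> carrier R" "f \<notin> P" "\<forall>J\<in>F - {P}. f \<in> J"
      by blast
    have "P = {g \<in> carrier R. f \<otimes> g \<in> I}"
      using f P colon ideal.Icarr[OF ideal[OF P]] by auto
    then show "P \<in> associated_primes R I"
      using F(2)[OF P] f(1) by (auto simp: associated_primes_def)
  qed
qed

text \<open>
  The element \<open>f\<close> says that \<open>I\<close> and \<open>Q\<close> agree after localization at \<open>Q\<close>. A factor \<open>f\<close> can be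
  cancelled in every primary component whose radical is inside \<open>Q\<close>, and the remaining components share
  an element \<open>h\<close> outside \<open>Q\<close>, so the result does not depend on the decomposition. This is essential: the definition of the symbolic power picks an arbitrary decomposition, which may contain
  redundant components that are not prime.
\<close>

lemma (in cring) sub_component_eq_prime:
  assumes D: "primary_decomposition R I D"
    and prime: "primeideal Q R" and "I \<subseteq> Q"
    and f: "f \<in> carrier R" "f \<notin> Q" "\<And>p. p \<in> Q \<Longrightarrow> p \<otimes> f \<in> I"
  shows "sub_component R D Q = Q"
proof -
  have D': "finite D" "\<And>J. J \<in> D \<Longrightarrow> primary_ideal R J" "\<And>J. J \<in> D \<Longrightarrow> ideal J R"
      "I = carrier R \<inter> \<Inter>D"
    using D by (auto simp: primary_decomposition_def primary_ideal_def)
  show ?thesis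
  proof (intro Set.set_eqI iffI)
    fix p assume p: "p \<in> sub_component R D Q"
    let ?K = "{J \<in> D. \<not> radical R J \<subseteq> Q}"
    have "\<exists>h \<in> carrier R. h \<notin> Q \<and> (\<forall>J\<in>?K. h \<in> J)"
    proof (rule finite_inter_not_subset_prime[OF prime])
      show "finite ?K"
        using D'(1) by simp
      show "ideal J R" "\<not> J \<subseteq> Q" if "J \<in> ?K" for J
        using that D'(3)[of J] radical_subset_prime[OF prime, of J] by simp_all blast
    qed
    then obtain h where h: "h \<in> carrier R" "h \<notin> Q" "\<forall>J\<in>?K. h \<in> J"
      by blast
    have pR: "p \<in> carrier R" and pJ: "\<And>J. J \<in> D \<Longrightarrow> radical R J \<subseteq> Q \<Longrightarrow> p \<in> J"
      using p by (auto simp: sub_component_def)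
    have "p \<otimes> h \<in> J" if J: "J \<in> D" for J
    proof (cases "radical R J \<subseteq> Q")
      case True
      then show ?thesis
        by (intro ideal.I_r_closed[OF D'(3)[OF J]] pJ[OF J] h(1))
    next
      case False
      then show ?thesis
        using h(3) J pR by (intro ideal.I_l_closed[OF D'(3)[OF J]]) auto
    qed
    then have "p \<otimes> h \<in> I"
      using D'(4) pR h(1) by auto
    then show "p \<in> Q"
      using primeideal.I_prime[OF prime pR h(1)] h(2) \<open>I \<subseteq> Q\<close> by auto
  next
    fix p assume p: "p \<in> Q"
    have pR: "p \<in> carrier R"
      by (rule ideal.Icarr[OF primeideal.axioms(1)[OF prime] p])
    have "p \<in> J" if J: "J \<in> D" "radical R J \<subseteq> Q" for J
    proof -
      have "p \<otimes> f \<in> J"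
        using f(3)[OF p] D'(4) J(1) by auto
      then have "p \<in> J \<or> f \<in> radical R J"
        using D'(2)[OF J(1)] pR f(1) by (auto simp: primary_ideal_def)
      then show ?thesis
        using J(2) f(2) by auto
    qed
    then show "p \<in> sub_component R D Q"
      using pR by (auto simp: sub_component_def)
  qed
qed

text \<open>
  The associated primes of \<open>I\<close> are the members of \<open>F\<close>, all of them maximal since \<open>F\<close> is an antichain,
  and the component at each of them is the prime itself.
\<close>

lemma (in cring) symbolic_power_inter_primes:
  assumes F: "finite F" "\<And>P. P \<in> F \<Longrightarrow> primeideal P R"
    and antichain: "\<And>P Q. P \<in> F \<Longrightarrow> Q \<in> F \<Longrightarrow> P \<subseteq> Q \<Longrightarrow> P = Q"
    and I: "I = carrier R \<inter> \<Inter>F"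
  shows "symbolic_power R I s = carrier R \<inter> (\<Inter>P\<in>F. P [^]\<^bsub>ideals_set R\<^esub> s)"
proof -
  have ideal: "ideal P R" if "P \<in> F" for P
    by (rule primeideal.axioms(1)[OF F(2)[OF that]])
  have "primary_decomposition R I F"
    using F I prime_imp_primary by (auto simp: primary_decomposition_def)
  then have D: "primary_decomposition R I (SOME D. primary_decomposition R I D)"
    by (rule someI)
  have "max_associated_primes R I = F"
    using associated_primes_inter_primes[OF F antichain I] antichain
    by (auto simp: max_associated_primes_def)
  moreover have "sub_component R (SOME D. primary_decomposition R I D) P = P" if P: "P \<in> F" for P
  proof -
    have "\<exists>f \<in> carrier R. f \<notin> P \<and> (\<forall>J\<in>F - {P}. f \<in> J)"
      by (rule finite_inter_not_subset_prime) (use F ideal P antichain in auto)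
    then obtain f where f: "f \<in> carrier R" "f \<notin> P" "\<forall>J\<in>F - {P}. f \<in> J"
      by blast
    have "p \<otimes> f \<in> I" if p: "p \<in> P" for p
    proof -
      have pR: "p \<in> carrier R"
        using ideal.Icarr[OF ideal[OF P] p] .
      have "p \<otimes> f \<in> J" if J: "J \<in> F" for J
        using ideal.I_r_closed[OF ideal[OF J]] ideal.I_l_closed[OF ideal[OF J]] f J p pR
        by (cases "J = P") auto
      then show ?thesis
        using f(1) pR by (auto simp: I)
    qed
    then show ?thesis
      using sub_component_eq_prime[OF D F(2)[OF P] _ f(1,2)] P by (auto simp: I)
  qed
  ultimately show ?thesis
    by (simp add: symbolic_power_def)
qed


section \<open>Monomial ideals\<close>

definition exps :: "'v set \<Rightarrow> ('v \<Rightarrow>\<^sub>0 nat) set" where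
  "exps V = {t. Poly_Mapping.keys t \<subseteq> V}"

text \<open>
  For an upward closed set of exponents this is the monomial ideal with exactly these monomials. The
  polynomial ideals of the proof all have this form, which turns statements on them into statements on
  exponents.
\<close>

definition monomial_span :: "('v \<Rightarrow>\<^sub>0 nat) set \<Rightarrow> ('v, 'k::comm_ring_1) mpoly set" where
  "monomial_span U = {p. Poly_Mapping.keys p \<subseteq> U}"

definition upward_closed :: "'v set \<Rightarrow> ('v \<Rightarrow>\<^sub>0 nat) set \<Rightarrow> bool" where
  "upward_closed V U \<longleftrightarrow> U \<subseteq> exps V \<and> (\<forall>t\<in>U. \<forall>u\<in>exps V. t + u \<in> U)"

lemma poly_ring_simps [simp]:
  "carrier (poly_ring V) = monomial_span (exps V)"
  "p \<otimes>\<^bsub>poly_ring V\<^esub> q = p * q" "p \<oplus>\<^bsub>poly_ring V\<^esub> q = p + q"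
  "\<one>\<^bsub>poly_ring V\<^esub> = 1" "\<zero>\<^bsub>poly_ring V\<^esub> = 0"
  by (auto simp: poly_ring_def monomial_span_def exps_def)

lemma keys_add_nat: "Poly_Mapping.keys (t + u :: 'v \<Rightarrow>\<^sub>0 nat) = Poly_Mapping.keys t \<union> Poly_Mapping.keys u"
  by (auto simp: in_keys_iff lookup_add)

lemma exps_add_iff [simp]: "t + u \<in> exps V \<longleftrightarrow> t \<in> exps V \<and> u \<in> exps V"
  by (auto simp: exps_def keys_add_nat)

lemma single_in_exps [simp]: "x \<in> V \<Longrightarrow> Poly_Mapping.single x n \<in> exps V"
  by (auto simp: exps_def)

lemma zero_in_exps [simp]: "0 \<in> exps V"
  by (simp add: exps_def)

lemma single_in_monomial_span_iff [simp]:
  "Poly_Mapping.single t c \<in> monomial_span U \<longleftrightarrow> c = 0 \<or> t \<in> U"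
  by (auto simp: monomial_span_def)

lemma sum_single_lookup:
  fixes p :: "'a \<Rightarrow>\<^sub>0 'b::comm_monoid_add"
  assumes "finite T" "Poly_Mapping.keys p \<subseteq> T"
  shows "(\<Sum>t\<in>T. Poly_Mapping.single t (Poly_Mapping.lookup p t)) = p"
proof (rule poly_mapping_eqI)
  fix t
  show "Poly_Mapping.lookup (\<Sum>t\<in>T. Poly_Mapping.single t (Poly_Mapping.lookup p t)) t
      = Poly_Mapping.lookup p t"
    using assms by (auto simp: lookup_sum lookup_single when_def in_keys_iff)
qed

lemma ideal_monomial_span:
  assumes "upward_closed V U"
  shows "ideal (monomial_span U :: ('v, 'k::comm_ring_1) mpoly set) (poly_ring V)"
proof -
  interpret R: cring "poly_ring V :: ('v, 'k) mpoly ring"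
    by (rule cring_poly_ring)
  have sub: "monomial_span U \<subseteq> (monomial_span (exps V) :: ('v, 'k) mpoly set)"
    using assms by (auto simp: monomial_span_def upward_closed_def)
  have mult: "p * q \<in> monomial_span U"
    if "p \<in> monomial_span U" "q \<in> monomial_span (exps V)" for p q :: "('v, 'k) mpoly"
    using that assms keys_mult[of p q] unfolding monomial_span_def upward_closed_def by fast
  show ?thesis
  proof (rule idealI[OF R.ring_axioms])
    show "subgroup (monomial_span U) (add_monoid (poly_ring V :: ('v, 'k) mpoly ring))"
    proof (rule R.add.subgroupI)
      show "(monomial_span U :: ('v, 'k) mpoly set) \<noteq> {}"
        by (auto simp: monomial_span_def intro!: exI[of _ 0])
      show "\<ominus>\<^bsub>poly_ring V\<^esub> p \<in> monomial_span U" if p: "p \<in> monomial_span U" for p :: "('v, 'k) mpoly"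
      proof -
        have m: "- p \<in> monomial_span U"
          using p by (auto simp: monomial_span_def in_keys_iff)
        have "\<ominus>\<^bsub>poly_ring V\<^esub> p = - p"
          by (rule R.minus_equality) (use m p sub in auto)
        then show ?thesis
          using m by simp
      qed
      show "p \<oplus>\<^bsub>poly_ring V\<^esub> q \<in> monomial_span U"
        if "p \<in> monomial_span U" "q \<in> monomial_span U" for p q :: "('v, 'k) mpoly"
        using that Poly_Mapping.keys_add[of p q] by (auto simp: monomial_span_def)
    qed (use sub in auto)
    show "x \<otimes>\<^bsub>poly_ring V\<^esub> a \<in> monomial_span U" "a \<otimes>\<^bsub>poly_ring V\<^esub> x \<in> monomial_span U"
      if "a \<in> monomial_span U" "x \<in> carrier (poly_ring V)" for a x :: "('v, 'k) mpoly"
      using mult[of a x] that by (auto simp: mult.commute)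
  qed
qed

text \<open>
  Stated for sets closed under addition rather than for ideals, since a polynomial is merely the sum
  of its terms.
\<close>

lemma monomial_span_subset_if_add_closed:
  fixes J :: "('v, 'k::comm_ring_1) mpoly set"
  assumes "0 \<in> J" and "\<And>p q. p \<in> J \<Longrightarrow> q \<in> J \<Longrightarrow> p + q \<in> J"
    and "\<And>t c. t \<in> U \<Longrightarrow> Poly_Mapping.single t c \<in> J"
  shows "monomial_span U \<subseteq> J"
proof
  fix p :: "('v, 'k) mpoly" assume p: "p \<in> monomial_span U"
  have "(\<Sum>t\<in>T. Poly_Mapping.single t (Poly_Mapping.lookup p t)) \<in> J" if "finite T" "T \<subseteq> U" for T
    using that assms by (induction T rule: finite_induct) auto
  from this[of "Poly_Mapping.keys p"] show "p \<in> J"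
    using p by (simp add: sum_single_lookup monomial_span_def)
qed

lemma ideal_add_closed: "ideal J (poly_ring V) \<Longrightarrow> p \<in> J \<Longrightarrow> q \<in> J \<Longrightarrow> p + q \<in> J"
  using additive_subgroup.a_closed[OF ideal.axioms(1), of J "poly_ring V" p q] by simp

lemma ideal_zero_mem: "ideal J (poly_ring V) \<Longrightarrow> 0 \<in> J"
  using additive_subgroup.zero_closed[OF ideal.axioms(1), of J "poly_ring V"] by simp

lemma genideal_monomials:
  assumes "A \<subseteq> exps V"
  shows "Idl\<^bsub>poly_ring V\<^esub> ((\<lambda>t. Poly_Mapping.single t (1::'k::comm_ring_1)) ` A)
    = monomial_span {a + u | a u. a \<in> A \<and> u \<in> exps V}" (is "Idl\<^bsub>_\<^esub> ?A = monomial_span ?U")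
proof
  interpret R: cring "poly_ring V :: ('a, 'k) mpoly ring"
    by (rule cring_poly_ring)
  have car: "?A \<subseteq> carrier (poly_ring V)"
    using assms by auto
  have id: "ideal (Idl\<^bsub>poly_ring V\<^esub> ?A) (poly_ring V)"
    by (rule R.genideal_ideal[OF car])
  show "Idl\<^bsub>poly_ring V\<^esub> ?A \<subseteq> monomial_span ?U"
  proof (rule R.genideal_minimal[OF ideal_monomial_span])
    show "upward_closed V ?U"
      using assms unfolding upward_closed_def by (fastforce simp: add.assoc)
    show "?A \<subseteq> monomial_span ?U"
      by force
  qed
  show "monomial_span ?U \<subseteq> Idl\<^bsub>poly_ring V\<^esub> ?A"
  proof (rule monomial_span_subset_if_add_closed[OF ideal_zero_mem[OF id] ideal_add_closed[OF id]])
    fix t and c :: 'k assume "t \<in> ?U"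
    then obtain a u where t: "t = a + u" "a \<in> A" "u \<in> exps V"
      by auto
    have "Poly_Mapping.single a 1 \<in> Idl\<^bsub>poly_ring V\<^esub> ?A"
      using R.genideal_self[OF car] t(2) by auto
    then have "Poly_Mapping.single a 1 \<otimes>\<^bsub>poly_ring V\<^esub> Poly_Mapping.single u c \<in> Idl\<^bsub>poly_ring V\<^esub> ?A"
      by (rule ideal.I_r_closed[OF id]) (use t in auto)
    then show "Poly_Mapping.single t c \<in> Idl\<^bsub>poly_ring V\<^esub> ?A"
      by (simp add: mult_single t)
  qed
qed

definition weight :: "'v set \<Rightarrow> ('v \<Rightarrow>\<^sub>0 nat) \<Rightarrow> nat" where
  "weight C t = (\<Sum>x\<in>C. Poly_Mapping.lookup t x)"

lemma weight_add [simp]: "weight C (t + u) = weight C t + weight C u"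
  by (simp add: weight_def lookup_add sum.distrib)

lemma weight_zero [simp]: "weight C 0 = 0"
  by (simp add: weight_def)

lemma weight_single [simp]: "finite C \<Longrightarrow> weight C (Poly_Mapping.single x n) = (if x \<in> C then n else 0)"
  by (simp add: weight_def lookup_single when_def)

lemma weight_mono: "finite C' \<Longrightarrow> C \<subseteq> C' \<Longrightarrow> weight C t \<le> weight C' t"
  unfolding weight_def by (rule sum_mono2) auto

lemma weight_pos_iff: "finite C \<Longrightarrow> 1 \<le> weight C t \<longleftrightarrow> Poly_Mapping.keys t \<inter> C \<noteq> {}"
  using sum_eq_0_iff[of C "Poly_Mapping.lookup t"]
  by (auto simp: weight_def in_keys_iff Suc_le_eq simp del: sum_eq_0_iff)

lemma keys_member_split:
  assumes "x \<in> Poly_Mapping.keys (t :: 'v \<Rightarrow>\<^sub>0 nat)"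
  obtains u where "t = u + Poly_Mapping.single x 1"
proof
  show "t = (t - Poly_Mapping.single x 1) + Poly_Mapping.single x 1"
    using assms by (intro poly_mapping_eqI)
      (auto simp: lookup_add lookup_minus lookup_single when_def in_keys_iff)
qed

section \<open>Minimal generators\<close>

definition min_exps :: "('v \<Rightarrow>\<^sub>0 nat) set \<Rightarrow> ('v \<Rightarrow>\<^sub>0 nat) set" where
  "min_exps U = {t \<in> U. \<forall>u\<in>U. \<forall>w. t = u + w \<longrightarrow> w = 0}"

text \<open>
  Every exponent of \<open>U\<close> lies above a minimal one, because passing to a proper divisor lowers the total
  degree \<open>weight V\<close>.
\<close>

lemma upset_min_exps:
  assumes V: "finite V" and U: "upward_closed V U"
  shows "{a + u | a u. a \<in> min_exps U \<and> u \<in> exps V} = U" (is "?L = U")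
proof
  show "?L \<subseteq> U"
    using U by (auto simp: upward_closed_def min_exps_def)
  have "t \<in> ?L" if "t \<in> U" for t
    using that
  proof (induction "weight V t" arbitrary: t rule: less_induct)
    case less
    have tV: "t \<in> exps V"
      using U less.prems by (auto simp: upward_closed_def)
    show ?case
    proof (cases "t \<in> min_exps U")
      case True
      then have "t = t + 0 \<and> t \<in> min_exps U \<and> 0 \<in> exps V"
        by simp
      then show ?thesis
        by blast
    next
      case False
      then obtain u w where w: "u \<in> U" "t = u + w" "w \<noteq> 0"
        using less.prems by (auto simp: min_exps_def)
      have "Poly_Mapping.keys w \<subseteq> V" "Poly_Mapping.keys w \<noteq> {}"
        using tV w by (auto simp: exps_def keys_add_nat)
      then have "Poly_Mapping.keys w \<inter> V \<noteq> {}"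
        by blast
      then have "weight V u < weight V t"
        using weight_pos_iff[OF V, of w] w(2) by simp
      then obtain a v where "u = a + v" "a \<in> min_exps U" "v \<in> exps V"
        using less.hyps[OF _ w(1)] by blast
      then have "t = a + (v + w) \<and> a \<in> min_exps U \<and> v + w \<in> exps V"
        using tV w(2) by (simp add: add.assoc)
      then show ?thesis
        by blast
    qed
  qed
  then show "U \<subseteq> ?L"
    by blast
qed

lemma monomial_span_inject:
  assumes "monomial_span U = (monomial_span U' :: ('v, 'k::comm_ring_1) mpoly set)"
  shows "U = U'"
proof -
  have "t \<in> U \<longleftrightarrow> t \<in> U'" for t
    using single_in_monomial_span_iff[of t "1::'k" U] single_in_monomial_span_iff[of t "1::'k" U'] assms
    by simp
  then show ?thesis
    by blast
qed

text \<open>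
  Any set of monomials that generates the ideal must contain each minimal monomial, since the only
  monomial of the ideal that divides it is itself. As the minimal monomials already generate, they
  are the one irredundant generating set.
\<close>

lemma min_monomial_gens_monomial_span:
  assumes V: "finite V" and U: "upward_closed V U"
  shows "min_monomial_gens V (monomial_span U)
    = (\<lambda>t. Poly_Mapping.single t (1::'k::comm_ring_1)) ` min_exps U" (is "_ = ?mon ` _")
proof -
  let ?I = "monomial_span U :: ('a, 'k) mpoly set"
  have minV: "min_exps U \<subseteq> exps V"
    using U by (auto simp: min_exps_def upward_closed_def)
  have gen: "Idl\<^bsub>poly_ring V\<^esub> (?mon ` min_exps U) = ?I"
    by (simp add: genideal_monomials[OF minV] upset_min_exps[OF V U])
  have least: "?mon ` min_exps U \<subseteq> A" if A: "A \<subseteq> monomials V" "Idl\<^bsub>poly_ring V\<^esub> A = ?I" for A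
  proof -
    let ?B = "{t \<in> exps V. ?mon t \<in> A}"
    have A_eq: "A = ?mon ` ?B"
      using A(1) by (auto simp: monomials_def exps_def)
    have "monomial_span {a + u | a u. a \<in> ?B \<and> u \<in> exps V} = ?I"
      using genideal_monomials[of ?B V, where 'k = 'k] A(2) A_eq by auto
    then have U_eq: "{a + u | a u. a \<in> ?B \<and> u \<in> exps V} = U"
      by (rule monomial_span_inject)
    have "t \<in> ?B" if t: "t \<in> min_exps U" for t
    proof -
      obtain a u where a: "t = a + u" "a \<in> ?B" "u \<in> exps V"
        using t U_eq unfolding min_exps_def by blast
      have "a = a + 0 \<and> a \<in> ?B \<and> 0 \<in> exps V"
        using a(2) by simp
      then have "a \<in> U"
        using U_eq by blast
      then have "u = 0"
        using t a(1) by (auto simp: min_exps_def)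
      then show ?thesis
        using a by simp
    qed
    then show ?thesis
      by auto
  qed
  have min: "is_min_monomial_gens V ?I (?mon ` min_exps U)"
    unfolding is_min_monomial_gens_def
  proof (intro conjI allI impI)
    show mons: "?mon ` min_exps U \<subseteq> monomials V"
      using minV by (auto simp: monomials_def exps_def)
    fix B assume "B \<subset> ?mon ` min_exps U"
    then show "Idl\<^bsub>poly_ring V\<^esub> B \<noteq> ?I"
      using least[of B] mons by blast
  qed (rule gen)
  show ?thesis
    unfolding min_monomial_gens_def
  proof (rule the_equality)
    show "is_min_monomial_gens V ?I (?mon ` min_exps U)"
      by (rule min)
    fix A assume A: "is_min_monomial_gens V ?I A"
    then have "?mon ` min_exps U \<subseteq> A"
      by (intro least) (auto simp: is_min_monomial_gens_def)
    then show "A = ?mon ` min_exps U"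
      using A gen unfolding is_min_monomial_gens_def by blast
  qed
qed

section \<open>Ideals generated by variables\<close>

text \<open>
  For a finite set \<open>C\<close> of variables in \<open>V\<close> and \<open>s = 1\<close>, this is the ideal generated by \<open>C\<close>; in general
  it is the \<open>s\<close>-th power of that ideal.
\<close>

definition weight_ideal :: "'v set \<Rightarrow> 'v set \<Rightarrow> nat \<Rightarrow> ('v, 'k::comm_ring_1) mpoly set" where
  "weight_ideal V C s = monomial_span {t \<in> exps V. s \<le> weight C t}"

lemma ideal_weight_ideal: "ideal (weight_ideal V C s) (poly_ring V)"
  unfolding weight_ideal_def by (rule ideal_monomial_span) (auto simp: upward_closed_def)

text \<open>
  Discard from \<open>p\<close> and \<open>q\<close> all terms that involve a variable of \<open>C\<close>. If neither polynomial lies in the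
  ideal, two nonzero polynomials \<open>p0\<close> and \<open>q0\<close> without these variables remain. Modulo the ideal,
  \<open>p * q\<close> is \<open>p0 * q0\<close>, which is nonzero and again free of the variables of \<open>C\<close>. The order on the
  variables makes the polynomials an integral domain, through leading terms.
\<close>

lemma primeideal_weight_ideal:
  "primeideal (weight_ideal V C 1 :: ('v::linorder, 'k::field) mpoly set) (poly_ring V)"
proof (rule primeidealI[OF ideal_weight_ideal cring_poly_ring])
  have "(1 :: ('v, 'k) mpoly) \<notin> weight_ideal V C 1" "(1 :: ('v, 'k) mpoly) \<in> carrier (poly_ring V)"
    by (simp_all flip: single_one add: weight_ideal_def)
  then show "carrier (poly_ring V :: ('v, 'k) mpoly ring) \<noteq> weight_ideal V C 1"
    by blast
next
  let ?P = "weight_ideal V C 1 :: ('v, 'k) mpoly set"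
  have split: "\<exists>p0. p0 \<noteq> 0 \<and> p0 \<in> monomial_span {t \<in> exps V. weight C t = 0} \<and> p0 - p \<in> ?P"
    if p: "p \<in> carrier (poly_ring V)" "p \<notin> ?P" for p :: "('v, 'k) mpoly"
  proof -
    define T where "T = {t \<in> Poly_Mapping.keys p. weight C t = 0}"
    define p0 where "p0 = (\<Sum>t\<in>T. Poly_Mapping.single t (Poly_Mapping.lookup p t))"
    have "finite T"
      by (simp add: T_def)
    then have lookup: "Poly_Mapping.lookup p0 t = (if t \<in> T then Poly_Mapping.lookup p t else 0)" for t
      by (simp add: p0_def lookup_sum lookup_single when_def)
    have keys_p: "Poly_Mapping.keys p \<subseteq> exps V"
      using p(1) by (simp add: monomial_span_def)
    then have "\<not> (\<forall>t\<in>Poly_Mapping.keys p. 1 \<le> weight C t)"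
      using p(2) by (auto simp: weight_ideal_def monomial_span_def)
    then obtain t where "t \<in> Poly_Mapping.keys p" "\<not> 1 \<le> weight C t"
      by blast
    then have "t \<in> T"
      by (simp add: T_def)
    then have "Poly_Mapping.lookup p0 t \<noteq> 0"
      by (auto simp: lookup T_def in_keys_iff)
    then have "p0 \<noteq> 0"
      by auto
    moreover have "p0 \<in> monomial_span {t \<in> exps V. weight C t = 0}"
      using keys_p by (auto simp: monomial_span_def in_keys_iff lookup T_def split: if_splits)
    moreover have "p0 - p \<in> ?P"
      using keys_p by (auto simp: weight_ideal_def monomial_span_def in_keys_iff lookup_minus lookup
          T_def Suc_le_eq split: if_splits)
    ultimately show ?thesis
      by blast
  qed
  fix p q :: "('v, 'k) mpoly"
  assume car: "p \<in> carrier (poly_ring V)" "q \<in> carrier (poly_ring V)"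
    and pq: "p \<otimes>\<^bsub>poly_ring V\<^esub> q \<in> ?P"
  show "p \<in> ?P \<or> q \<in> ?P"
  proof (rule ccontr)
    assume "\<not> (p \<in> ?P \<or> q \<in> ?P)"
    then have "p \<notin> ?P" "q \<notin> ?P"
      by auto
    obtain p0 where p0: "p0 \<noteq> 0" "p0 \<in> monomial_span {t \<in> exps V. weight C t = 0}" "p0 - p \<in> ?P"
      using split[OF car(1) \<open>p \<notin> ?P\<close>] by blast
    obtain q0 where q0: "q0 \<noteq> 0" "q0 \<in> monomial_span {t \<in> exps V. weight C t = 0}" "q0 - q \<in> ?P"
      using split[OF car(2) \<open>q \<notin> ?P\<close>] by blast
    have "p0 \<in> carrier (poly_ring V)"
      using p0(2) by (auto simp: monomial_span_def)
    then have "(p0 - p) * q \<in> ?P" "p0 * (q0 - q) \<in> ?P"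
      using ideal.I_r_closed[OF ideal_weight_ideal p0(3) car(2)]
        ideal.I_l_closed[OF ideal_weight_ideal q0(3), of p0] by simp_all
    \<comment> \<open>This sum equals \<open>p0 * q0\<close>.\<close>
    then have "p * q + (p0 - p) * q + p0 * (q0 - q) \<in> ?P"
      using pq by (intro ideal_add_closed[OF ideal_weight_ideal]) simp_all
    then have "p0 * q0 \<in> ?P"
      by (simp add: algebra_simps)
    moreover have "p0 * q0 \<in> monomial_span {t \<in> exps V. weight C t = 0}"
      using p0(2) q0(2) keys_mult[of p0 q0] unfolding monomial_span_def by fastforce
    ultimately have "t \<notin> Poly_Mapping.keys (p0 * q0)" for t
      unfolding weight_ideal_def monomial_span_def by fastforce
    then have "p0 * q0 = 0"
      by (intro poly_mapping_eqI) (simp add: in_keys_iff)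
    then show False
      using p0(1) q0(1) by simp
  qed
qed

text \<open>
  For the inductive step, a monomial of weight at least \<open>Suc s\<close> is divisible by a variable of \<open>C\<close>, and
  dividing by it lowers the weight by exactly one.
\<close>

lemma weight_ideal_power:
  assumes "finite C" "C \<subseteq> V"
  shows "weight_ideal V C 1 [^]\<^bsub>ideals_set (poly_ring V)\<^esub> s
    = (weight_ideal V C s :: ('v, 'k::comm_ring_1) mpoly set)"
proof (induction s)
  case 0
  then show ?case
    by (simp add: ideals_set_def weight_ideal_def)
next
  case (Suc s)
  let ?P = "\<lambda>s. weight_ideal V C s :: ('v, 'k) mpoly set"
  interpret R: cring "poly_ring V :: ('v, 'k) mpoly ring"
    by (rule cring_poly_ring)
  have id: "ideal (ideal_prod (poly_ring V) (?P s) (?P 1)) (poly_ring V)"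
    by (rule R.ideal_prod_is_ideal[OF ideal_weight_ideal ideal_weight_ideal])
  have "ideal_prod (poly_ring V) (?P s) (?P 1) = ?P (Suc s)"
  proof
    show "ideal_prod (poly_ring V) (?P s) (?P 1) \<subseteq> ?P (Suc s)"
    proof
      fix p assume "p \<in> ideal_prod (poly_ring V) (?P s) (?P 1)"
      then show "p \<in> ?P (Suc s)"
      proof induction
        case (prod i j)
        then show ?case
          using keys_mult[of i j] unfolding weight_ideal_def monomial_span_def by fastforce
      next
        case (sum p q)
        then show ?case
          using ideal_add_closed[OF ideal_weight_ideal] by simp
      qed
    qed
    show "?P (Suc s) \<subseteq> ideal_prod (poly_ring V) (?P s) (?P 1)"
      unfolding weight_ideal_def[of V C "Suc s"]
    proof (rule monomial_span_subset_if_add_closed[OF ideal_zero_mem[OF id] ideal_add_closed[OF id]])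
      fix t and c :: 'k assume t: "t \<in> {t \<in> exps V. Suc s \<le> weight C t}"
      then obtain x where x: "x \<in> Poly_Mapping.keys t" "x \<in> C"
        using weight_pos_iff[OF assms(1), of t] by auto
      obtain u where u: "t = u + Poly_Mapping.single x 1"
        using keys_member_split[OF x(1)] .
      have "Poly_Mapping.single u c \<in> ?P s"
          "Poly_Mapping.single (Poly_Mapping.single x 1) 1 \<in> ?P 1"
        using t x(2) u assms by (auto simp: weight_ideal_def)
      from ideal_prod.prod[OF this, of "poly_ring V"]
      show "Poly_Mapping.single t c \<in> ideal_prod (poly_ring V) (?P s) (?P 1)"
        by (simp add: mult_single u)
    qed
  qed
  then show ?case
    using Suc by (simp add: ideals_set_def)
qed

section \<open>Vertex covers and symbolic powers of edge ideals\<close>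

definition vertex_cover :: "'v ugraph \<Rightarrow> 'v set \<Rightarrow> bool" where
  "vertex_cover G C \<longleftrightarrow> C \<subseteq> verts G \<and> (\<forall>e\<in>edges G. e \<inter> C \<noteq> {})"

definition min_vertex_cover :: "'v ugraph \<Rightarrow> 'v set \<Rightarrow> bool" where
  "min_vertex_cover G C \<longleftrightarrow> vertex_cover G C \<and> (\<forall>C'. C' \<subset> C \<longrightarrow> \<not> vertex_cover G C')"

lemma vertex_cover_contains_min:
  assumes "finite (verts G)" "vertex_cover G C"
  obtains C' where "C' \<subseteq> C" "min_vertex_cover G C'"
proof -
  have "finite C"
    using assms finite_subset by (auto simp: vertex_cover_def)
  then have "\<exists>C'\<subseteq>C. min_vertex_cover G C'"
    using assms(2)
  proof (induction C rule: finite_psubset_induct)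
    case (psubset C)
    then show ?case
      unfolding min_vertex_cover_def by (meson order.trans psubset_imp_subset subset_refl)
  qed
  then show ?thesis
    using that by blast
qed

lemma edge_ideal_eq_monomial_span:
  fixes G :: "'v ugraph"
  assumes G: "simple_graph G"
  shows "(edge_ideal G :: ('v, 'k::comm_ring_1) mpoly set)
    = monomial_span {t \<in> exps (verts G). \<exists>e\<in>edges G. e \<subseteq> Poly_Mapping.keys t}"
proof -
  let ?A = "{Poly_Mapping.single x 1 + Poly_Mapping.single y 1 | x y. {x, y} \<in> edges G}
    :: ('v \<Rightarrow>\<^sub>0 nat) set"
  have xy: "x \<in> verts G" "y \<in> verts G" "x \<noteq> y" if "{x, y} \<in> edges G" for x y
  proof -
    have "{x, y} \<subseteq> verts G" "card {x, y} = 2"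
      using G that by (auto simp: simple_graph_def)
    then show "x \<in> verts G" "y \<in> verts G" "x \<noteq> y"
      by auto
  qed
  have "{mvar x * mvar y | x y. {x, y} \<in> edges G}
      = (\<lambda>t. Poly_Mapping.single t (1::'k)) ` ?A"
    by (auto simp: mvar_def mult_single)
  moreover have "?A \<subseteq> exps (verts G)"
    using xy by auto
  ultimately have "(edge_ideal G :: ('v, 'k) mpoly set)
      = monomial_span {a + u | a u. a \<in> ?A \<and> u \<in> exps (verts G)}"
    unfolding edge_ideal_def by (simp add: genideal_monomials)
  also have "{a + u | a u. a \<in> ?A \<and> u \<in> exps (verts G)}
      = {t \<in> exps (verts G). \<exists>e\<in>edges G. e \<subseteq> Poly_Mapping.keys t}" (is "?L = ?R")
  proof (intro equalityI subsetI)
    fix t assume "t \<in> ?L"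
    then obtain x y u where t: "t = Poly_Mapping.single x 1 + Poly_Mapping.single y 1 + u"
        "{x, y} \<in> edges G" "u \<in> exps (verts G)"
      by blast
    then have "t \<in> exps (verts G)" "{x, y} \<subseteq> Poly_Mapping.keys t"
      using xy[OF t(2)] by (simp_all add: keys_add_nat)
    then show "t \<in> ?R"
      using t(2) by blast
  next
    fix t assume t: "t \<in> ?R"
    then obtain e where e: "e \<in> edges G" "e \<subseteq> Poly_Mapping.keys t" "t \<in> exps (verts G)"
      by blast
    have "card e = 2"
      using G e(1) by (auto simp: simple_graph_def)
    then obtain x y where xy': "e = {x, y}" "x \<noteq> y"
      by (auto simp: card_2_iff)
    obtain u where u: "t = u + Poly_Mapping.single x 1"
      using keys_member_split[of x t] e(2) xy' by auto
    then have "y \<in> Poly_Mapping.keys u"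
      using e(2) xy' by (auto simp: keys_add_nat)
    then obtain v where "u = v + Poly_Mapping.single y 1"
      by (rule keys_member_split)
    then have "t = (Poly_Mapping.single x 1 + Poly_Mapping.single y 1) + v" "v \<in> exps (verts G)"
      using u e(3) by (simp_all add: ac_simps)
    then show "t \<in> ?L"
      using e(1) xy'(1) by blast
  qed
  finally show ?thesis .
qed

text \<open>
  A set without an edge has a vertex cover as its complement, and this cover contains a minimal one,
  which the set misses. Read for supports of monomials, this is the decomposition of the edge ideal
  into primes generated by the minimal vertex covers.
\<close>

lemma contains_edge_iff_meets_covers:
  assumes G: "simple_graph G" and S: "S \<subseteq> verts G"
  shows "(\<exists>e\<in>edges G. e \<subseteq> S) \<longleftrightarrow> (\<forall>C. min_vertex_cover G C \<longrightarrow> S \<inter> C \<noteq> {})"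
proof (intro iffI allI impI)
  fix C assume "\<exists>e\<in>edges G. e \<subseteq> S" and C: "min_vertex_cover G C"
  then obtain e where e: "e \<in> edges G" "e \<subseteq> S"
    by blast
  have "e \<inter> C \<noteq> {}"
    using C e(1) by (simp add: min_vertex_cover_def vertex_cover_def)
  then show "S \<inter> C \<noteq> {}"
    using e(2) by blast
next
  assume *: "\<forall>C. min_vertex_cover G C \<longrightarrow> S \<inter> C \<noteq> {}"
  show "\<exists>e\<in>edges G. e \<subseteq> S"
  proof (rule ccontr)
    assume "\<not> (\<exists>e\<in>edges G. e \<subseteq> S)"
    moreover have "e \<subseteq> verts G" if "e \<in> edges G" for e
      using G that by (simp add: simple_graph_def)
    ultimately have "vertex_cover G (verts G - S)"
      by (auto simp: vertex_cover_def)
    then obtain C where "C \<subseteq> verts G - S" "min_vertex_cover G C"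
      using vertex_cover_contains_min[of G "verts G - S"] G by (auto simp: simple_graph_def)
    then show False
      using * by blast
  qed
qed

text \<open>
  Quantifying over all covers gives the same set as quantifying over the minimal ones, since a larger
  cover has at least the same weight. All covers are easier to transport along the parallelization.
\<close>

definition symbolic_exps :: "'v ugraph \<Rightarrow> nat \<Rightarrow> ('v \<Rightarrow>\<^sub>0 nat) set" where
  "symbolic_exps G s = {t \<in> exps (verts G). \<forall>C. vertex_cover G C \<longrightarrow> s \<le> weight C t}"

lemma upward_closed_symbolic_exps: "upward_closed (verts G) (symbolic_exps G s)"
  by (auto simp: upward_closed_def symbolic_exps_def intro: trans_le_add1)

text \<open>
  The minimal vertex covers give an antichain of primes with intersection the edge ideal, so the
  symbolic power is the intersection of the \<open>s\<close>-th powers of these primes.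
\<close>

lemma symbolic_power_edge_ideal:
  fixes G :: "'v::linorder ugraph"
  assumes G: "simple_graph G"
  shows "symbolic_power (poly_ring (verts G)) (edge_ideal G :: ('v, 'k::field) mpoly set) s
    = monomial_span (symbolic_exps G s)"
proof -
  interpret R: cring "poly_ring (verts G) :: ('v, 'k) mpoly ring"
    by (rule cring_poly_ring)
  let ?C = "{C. min_vertex_cover G C}"
  let ?P = "\<lambda>C. weight_ideal (verts G) C 1 :: ('v, 'k) mpoly set"
  have fin: "finite (verts G)"
    using G by (simp add: simple_graph_def)
  have C: "C \<subseteq> verts G" "finite C" if "min_vertex_cover G C" for C
    using that fin finite_subset by (auto simp: min_vertex_cover_def vertex_cover_def)
  have "?C \<subseteq> Pow (verts G)"
    using C by auto
  then have finC: "finite ?C"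
    using fin finite_subset by blast
  have antichain: "C = C'" if C': "min_vertex_cover G C" "min_vertex_cover G C'" "?P C \<subseteq> ?P C'" for C C'
  proof -
    have "x \<in> C'" if x: "x \<in> C" for x
    proof -
      have "Poly_Mapping.single (Poly_Mapping.single x 1) 1 \<in> ?P C"
        using C[OF C'(1)] x by (auto simp: weight_ideal_def)
      then have "Poly_Mapping.single (Poly_Mapping.single x 1) 1 \<in> ?P C'"
        using C'(3) by blast
      then show ?thesis
        using C[OF C'(2)] by (auto simp: weight_ideal_def split: if_splits)
    qed
    then have "C \<subseteq> C'"
      by blast
    then show ?thesis
      using C'(1,2) by (auto simp: min_vertex_cover_def)
  qed
  have exps: "t \<in> exps (verts G) \<and> (\<exists>e\<in>edges G. e \<subseteq> Poly_Mapping.keys t)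
      \<longleftrightarrow> t \<in> exps (verts G) \<and> (\<forall>C\<in>?C. 1 \<le> weight C t)" for t
  proof (rule conj_cong[OF refl])
    assume "t \<in> exps (verts G)"
    then have "(\<exists>e\<in>edges G. e \<subseteq> Poly_Mapping.keys t)
        \<longleftrightarrow> (\<forall>C\<in>?C. Poly_Mapping.keys t \<inter> C \<noteq> {})"
      using contains_edge_iff_meets_covers[OF G, of "Poly_Mapping.keys t"] by (simp add: exps_def)
    also have "\<dots> \<longleftrightarrow> (\<forall>C\<in>?C. 1 \<le> weight C t)"
      using weight_pos_iff[OF C(2)] by (intro ball_cong) simp_all
    finally show "(\<exists>e\<in>edges G. e \<subseteq> Poly_Mapping.keys t) \<longleftrightarrow> (\<forall>C\<in>?C. 1 \<le> weight C t)" .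
  qed
  have I: "(edge_ideal G :: ('v, 'k) mpoly set) = carrier (poly_ring (verts G)) \<inter> \<Inter> (?P ` ?C)"
    unfolding edge_ideal_eq_monomial_span[OF G] exps
    by (auto simp: weight_ideal_def monomial_span_def)
  have "symbolic_power (poly_ring (verts G)) (edge_ideal G :: ('v, 'k) mpoly set) s
      = carrier (poly_ring (verts G))
        \<inter> (\<Inter>P\<in>?P ` ?C. P [^]\<^bsub>ideals_set (poly_ring (verts G))\<^esub> s)"
  proof (rule R.symbolic_power_inter_primes[OF _ _ _ I])
    show "finite (?P ` ?C)"
      using finC by simp
    show "primeideal P (poly_ring (verts G))" if "P \<in> ?P ` ?C" for P
      using that primeideal_weight_ideal by blast
    show "P = Q" if "P \<in> ?P ` ?C" "Q \<in> ?P ` ?C" "P \<subseteq> Q" for P Q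
      using that antichain by blast
  qed
  also have "\<dots> = carrier (poly_ring (verts G)) \<inter> (\<Inter>C\<in>?C. weight_ideal (verts G) C s)"
  proof -
    have "?P C [^]\<^bsub>ideals_set (poly_ring (verts G))\<^esub> s = weight_ideal (verts G) C s"
      if "C \<in> ?C" for C
      using that C by (intro weight_ideal_power) auto
    then have "(\<lambda>P. P [^]\<^bsub>ideals_set (poly_ring (verts G))\<^esub> s) ` ?P ` ?C
        = (\<lambda>C. weight_ideal (verts G) C s) ` ?C"
      unfolding image_image by (rule image_cong[OF refl])
    then show ?thesis
      by simp
  qed
  also have "\<dots> = monomial_span {t \<in> exps (verts G). \<forall>C\<in>?C. s \<le> weight C t}"
    by (auto simp: weight_ideal_def monomial_span_def)
  also have "{t \<in> exps (verts G). \<forall>C\<in>?C. s \<le> weight C t} = symbolic_exps G s"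
  proof -
    have "s \<le> weight C t" if C': "\<forall>C\<in>?C. s \<le> weight C t" "vertex_cover G C" for C t
    proof -
      obtain C0 where C0: "C0 \<subseteq> C" "min_vertex_cover G C0"
        using vertex_cover_contains_min[OF fin C'(2)] .
      have "finite C"
        using C'(2) fin finite_subset by (auto simp: vertex_cover_def)
      then show ?thesis
        using weight_mono[OF _ C0(1), of t] C0(2) C'(1) by fastforce
    qed
    then show ?thesis
      by (auto simp: symbolic_exps_def min_vertex_cover_def)
  qed
  finally show ?thesis .
qed

lemma min_monomial_gens_symbolic_power:
  fixes G :: "'v::linorder ugraph"
  assumes G: "simple_graph G"
  shows "min_monomial_gens (verts G)
      (symbolic_power (poly_ring (verts G)) (edge_ideal G :: ('v, 'k::field) mpoly set) s)
    = (\<lambda>t. Poly_Mapping.single t 1) ` min_exps (symbolic_exps G s)"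
  unfolding symbolic_power_edge_ideal[OF G]
  by (rule min_monomial_gens_monomial_span)
    (use G upward_closed_symbolic_exps in \<open>auto simp: simple_graph_def\<close>)

section \<open>Collapsing the copies\<close>

text \<open>
  The exponent of the monomial obtained by the substitution $x_{i,t} \mapsto x_i$.
\<close>

definition collapse :: "('v \<times> nat) set \<Rightarrow> ('v \<times> nat \<Rightarrow>\<^sub>0 nat) \<Rightarrow> ('v \<Rightarrow>\<^sub>0 nat)" where
  "collapse W t = (\<Sum>p\<in>W. Poly_Mapping.single (fst p) (Poly_Mapping.lookup t p))"

lemma collapse_add: "collapse W (t + u) = collapse W t + collapse W u"
  by (simp add: collapse_def lookup_add single_add sum.distrib)

lemma collapse_single:
  assumes "finite W" "p \<in> W"
  shows "collapse W (Poly_Mapping.single p n) = Poly_Mapping.single (fst p) n"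
proof -
  have "collapse W (Poly_Mapping.single p n)
      = (\<Sum>q\<in>W. if q = p then Poly_Mapping.single (fst p) n else 0)"
    unfolding collapse_def by (rule sum.cong) (auto simp: lookup_single when_def)
  then show ?thesis
    using assms by simp
qed

lemma lookup_collapse:
  assumes "finite W"
  shows "Poly_Mapping.lookup (collapse W t) x = weight {p \<in> W. fst p = x} t"
  using assms by (simp add: collapse_def lookup_sum lookup_single when_def weight_def sum.inter_filter)

lemma weight_collapse:
  assumes "finite C" "finite W"
  shows "weight C (collapse W t) = weight {p \<in> W. fst p \<in> C} t"
proof -
  have "weight C (collapse W t) = (\<Sum>p\<in>W. \<Sum>x\<in>C. Poly_Mapping.lookup t p when fst p = x)"
    unfolding weight_def collapse_def lookup_sum lookup_single by (rule sum.swap)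
  also have "\<dots> = (\<Sum>p\<in>W. if fst p \<in> C then Poly_Mapping.lookup t p else 0)"
    using assms by (intro sum.cong) (auto simp: when_def)
  finally show ?thesis
    using assms by (simp add: weight_def sum.inter_filter)
qed

lemma verts_parallelization: "verts (parallelization G \<alpha>) = (SIGMA x:verts G. {1..\<alpha> x})"
  by (auto simp: parallelization_def)

lemma vertex_cover_lift:
  assumes "vertex_cover G C"
  shows "vertex_cover (parallelization G \<alpha>) {p \<in> verts (parallelization G \<alpha>). fst p \<in> C}"
  unfolding vertex_cover_def
proof (intro conjI ballI)
  fix e assume "e \<in> edges (parallelization G \<alpha>)"
  then obtain x t y l where e: "e = {(x, t), (y, l)}" "{x, y} \<in> edges G"
      "1 \<le> t" "t \<le> \<alpha> x" "1 \<le> l" "l \<le> \<alpha> y"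
    by (auto simp: parallelization_def)
  moreover have "{x, y} \<inter> C \<noteq> {}" "C \<subseteq> verts G"
    using assms e(2) by (auto simp: vertex_cover_def)
  ultimately show "e \<inter> {p \<in> verts (parallelization G \<alpha>). fst p \<in> C} \<noteq> {}"
    by (auto simp: verts_parallelization)
qed auto

text \<open>
  Take the vertices all of whose copies lie in the cover \<open>D\<close>. If both ends of an edge failed this,
  a missing copy of one end and a missing copy of the other would form an edge that \<open>D\<close> does not
  cover.
\<close>

lemma vertex_cover_lower:
  assumes G: "simple_graph G" and D: "vertex_cover (parallelization G \<alpha>) D"
  obtains C where "vertex_cover G C" "{p \<in> verts (parallelization G \<alpha>). fst p \<in> C} \<subseteq> D"
proof
  let ?C = "{x \<in> verts G. \<forall>j\<in>{1..\<alpha> x}. (x, j) \<in> D}"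
  show "vertex_cover G ?C"
    unfolding vertex_cover_def
  proof (intro conjI ballI)
    fix e assume e: "e \<in> edges G"
    then have "e \<subseteq> verts G" "card e = 2"
      using G by (auto simp: simple_graph_def)
    then obtain x y where xy: "e = {x, y}" "x \<in> verts G" "y \<in> verts G"
      by (auto simp: card_2_iff)
    show "e \<inter> ?C \<noteq> {}"
    proof (rule ccontr)
      assume "\<not> e \<inter> ?C \<noteq> {}"
      then have "x \<notin> ?C" "y \<notin> ?C"
        using xy(1) by auto
      then obtain t l where tl: "t \<in> {1..\<alpha> x}" "(x, t) \<notin> D" "l \<in> {1..\<alpha> y}" "(y, l) \<notin> D"
        using xy by blast
      have "{(x, t), (y, l)} \<in> edges (parallelization G \<alpha>)"
        using e tl xy(1) by (auto simp: parallelization_def)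
      moreover have "\<forall>e\<in>edges (parallelization G \<alpha>). e \<inter> D \<noteq> {}"
        using D by (simp add: vertex_cover_def)
      ultimately have "{(x, t), (y, l)} \<inter> D \<noteq> {}"
        by (rule bspec[rotated])
      then show False
        using tl by simp
    qed
  qed auto
  show "{p \<in> verts (parallelization G \<alpha>). fst p \<in> ?C} \<subseteq> D"
    by (auto simp: verts_parallelization)
qed

lemma collapse_in_exps:
  assumes "finite W" "fst ` W \<subseteq> V"
  shows "collapse W t \<in> exps V"
proof -
  have "x \<in> V" if "Poly_Mapping.lookup (collapse W t) x \<noteq> 0" for x
  proof -
    have "\<exists>p\<in>{p \<in> W. fst p = x}. Poly_Mapping.lookup t p \<noteq> 0"
      using that unfolding lookup_collapse[OF assms(1)] weight_def by (meson sum.neutral)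
    then show ?thesis
      using assms(2) by auto
  qed
  then show ?thesis
    by (auto simp: exps_def in_keys_iff)
qed

text \<open>
  The weight of the collapsed exponent on a cover \<open>C\<close> is the weight of the original exponent on all
  copies of \<open>C\<close>. Covers of this shape suffice to test membership, because every cover of the
  parallelization contains one.
\<close>

lemma symbolic_exps_parallelization:
  assumes G: "simple_graph G"
  shows "t \<in> symbolic_exps (parallelization G \<alpha>) s \<longleftrightarrow>
    t \<in> exps (verts (parallelization G \<alpha>))
      \<and> collapse (verts (parallelization G \<alpha>)) t \<in> symbolic_exps G s"
proof -
  let ?W = "verts (parallelization G \<alpha>)"
  have fin: "finite (verts G)"
    using G by (simp add: simple_graph_def)
  have finW: "finite ?W"
    using fin by (simp add: verts_parallelization)
  have finC: "finite C" if "vertex_cover G C" for C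
    using that fin finite_subset by (auto simp: vertex_cover_def)
  have finD: "finite D" if "vertex_cover (parallelization G \<alpha>) D" for D
    using that finW finite_subset by (auto simp: vertex_cover_def)
  have exps: "collapse ?W t \<in> exps (verts G)"
    by (rule collapse_in_exps[OF finW]) (auto simp: verts_parallelization)
  have "(\<forall>D. vertex_cover (parallelization G \<alpha>) D \<longrightarrow> s \<le> weight D t)
      \<longleftrightarrow> (\<forall>C. vertex_cover G C \<longrightarrow> s \<le> weight C (collapse ?W t))"
  proof (intro iffI allI impI)
    fix C assume *: "\<forall>D. vertex_cover (parallelization G \<alpha>) D \<longrightarrow> s \<le> weight D t"
      and C: "vertex_cover G C"
    show "s \<le> weight C (collapse ?W t)"
      using * vertex_cover_lift[OF C] by (simp add: weight_collapse[OF finC[OF C] finW])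
  next
    fix D assume *: "\<forall>C. vertex_cover G C \<longrightarrow> s \<le> weight C (collapse ?W t)"
      and D: "vertex_cover (parallelization G \<alpha>) D"
    obtain C where C: "vertex_cover G C" "{p \<in> ?W. fst p \<in> C} \<subseteq> D"
      using vertex_cover_lower[OF G D] .
    have "s \<le> weight C (collapse ?W t)"
      using * C(1) by blast
    also have "\<dots> \<le> weight D t"
      unfolding weight_collapse[OF finC[OF C(1)] finW] by (rule weight_mono[OF finD[OF D] C(2)])
    finally show "s \<le> weight D t" .
  qed
  then show ?thesis
    using exps by (simp add: symbolic_exps_def)
qed

text \<open>
  Membership depends only on the collapsed exponent, so it remains to compare the possible
  divisions. Dividing by a copy of \<open>x\<close> divides the collapsed monomial by \<open>x\<close>. Conversely, if the
  collapsed monomial can be divided by \<open>x\<close>, some copy of \<open>x\<close> occurs in the original one and can be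
  divided off.
\<close>

lemma min_exps_parallelization:
  assumes G: "simple_graph G"
  shows "t \<in> min_exps (symbolic_exps (parallelization G \<alpha>) s) \<longleftrightarrow>
    t \<in> exps (verts (parallelization G \<alpha>))
      \<and> collapse (verts (parallelization G \<alpha>)) t \<in> min_exps (symbolic_exps G s)"
proof -
  let ?W = "verts (parallelization G \<alpha>)"
  let ?c = "collapse ?W"
  note sym = symbolic_exps_parallelization[OF G]
  have finW: "finite ?W"
    using G by (simp add: simple_graph_def verts_parallelization)
  show ?thesis
  proof (intro iffI conjI)
    assume t: "t \<in> min_exps (symbolic_exps (parallelization G \<alpha>) s)"
    then have tsym: "t \<in> symbolic_exps (parallelization G \<alpha>) s"
      by (simp add: min_exps_def)
    then show tW: "t \<in> exps ?W"
      by (simp add: sym)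
    show "?c t \<in> min_exps (symbolic_exps G s)"
      unfolding min_exps_def
    proof (intro CollectI conjI ballI allI impI)
      show "?c t \<in> symbolic_exps G s"
        using tsym by (simp add: sym)
      fix u w assume u: "u \<in> symbolic_exps G s" "?c t = u + w"
      show "w = 0"
      proof (rule ccontr)
        assume "w \<noteq> 0"
        then obtain x where x: "x \<in> Poly_Mapping.keys w"
          by (metis keys_eq_empty ex_in_conv)
        obtain w' where w': "w = w' + Poly_Mapping.single x 1"
          using keys_member_split[OF x] .
        have "Poly_Mapping.lookup (?c t) x \<noteq> 0"
          by (simp add: u(2) w' lookup_add)
        then have "\<exists>p\<in>{p \<in> ?W. fst p = x}. Poly_Mapping.lookup t p \<noteq> 0"
          unfolding lookup_collapse[OF finW] weight_def by (meson sum.neutral)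
        then obtain p where p: "p \<in> ?W" "fst p = x" "p \<in> Poly_Mapping.keys t"
          by (auto simp: in_keys_iff)
        obtain t' where t': "t = t' + Poly_Mapping.single p 1"
          using keys_member_split[OF p(3)] .
        have "?c t' + Poly_Mapping.single x 1 = (u + w') + Poly_Mapping.single x 1"
          using u(2) p(2) by (simp add: t' w' collapse_add collapse_single[OF finW p(1)] add.assoc)
        then have "?c t' = u + w'"
          by simp
        moreover have "?c t \<in> exps (verts G)"
          using \<open>?c t \<in> symbolic_exps G s\<close> by (simp add: symbolic_exps_def)
        then have "w' \<in> exps (verts G)"
          by (simp add: u(2) w')
        ultimately have "?c t' \<in> symbolic_exps G s"
          using u(1) upward_closed_symbolic_exps[of G s] by (simp add: upward_closed_def)
        then have "t' \<in> symbolic_exps (parallelization G \<alpha>) s"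
          using tW by (simp add: sym t')
        then have "Poly_Mapping.single p (1::nat) = 0"
          using t t' by (auto simp: min_exps_def)
        then show False
          by (metis lookup_single_eq lookup_zero one_neq_zero)
      qed
    qed
  next
    assume "t \<in> exps ?W \<and> ?c t \<in> min_exps (symbolic_exps G s)"
    then have t: "t \<in> exps ?W" "?c t \<in> symbolic_exps G s"
        "\<And>u w. u \<in> symbolic_exps G s \<Longrightarrow> ?c t = u + w \<Longrightarrow> w = 0"
      by (auto simp: min_exps_def)
    show "t \<in> min_exps (symbolic_exps (parallelization G \<alpha>) s)"
      unfolding min_exps_def
    proof (intro CollectI conjI ballI allI impI)
      show "t \<in> symbolic_exps (parallelization G \<alpha>) s"
        using t by (simp add: sym)
      fix u w assume u: "u \<in> symbolic_exps (parallelization G \<alpha>) s" "t = u + w"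
      have "?c w = 0"
        using t(3)[of "?c u" "?c w"] u by (simp add: sym collapse_add)
      \<comment> \<open>Only the monomial 1 collapses to 1.\<close>
      have "Poly_Mapping.keys w \<inter> ?W = {}"
      proof (rule ccontr)
        assume "Poly_Mapping.keys w \<inter> ?W \<noteq> {}"
        then obtain p where p: "p \<in> Poly_Mapping.keys w" "p \<in> ?W"
          by blast
        obtain v where "w = v + Poly_Mapping.single p 1"
          using keys_member_split[OF p(1)] .
        then have "Poly_Mapping.lookup (?c w) (fst p) \<noteq> 0"
          by (simp add: collapse_add collapse_single[OF finW p(2)] lookup_add)
        then show False
          by (simp add: \<open>?c w = 0\<close>)
      qed
      moreover have "Poly_Mapping.keys w \<subseteq> ?W"
        using t(1) u(2) by (simp add: exps_def keys_add_nat)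
      ultimately have "Poly_Mapping.keys w = {}"
        by blast
      then show "w = 0"
        by simp
    qed
  qed
qed

section \<open>Monomials as products of powers of variables\<close>

lemma mvar_power: "mvar x ^ n = Poly_Mapping.single (Poly_Mapping.single x n) 1"
proof (induction n)
  case (Suc n)
  have "Poly_Mapping.single x (Suc n) = Poly_Mapping.single x 1 + Poly_Mapping.single x n"
    by (simp flip: single_add)
  then show ?case
    by (simp only: power_Suc Suc) (simp add: mvar_def mult_single)
qed simp

lemma prod_mvar_power:
  assumes "finite V"
  shows "(\<Prod>x\<in>V. mvar x ^ f x) = Poly_Mapping.single (\<Sum>x\<in>V. Poly_Mapping.single x (f x)) 1"
  using assms by (induction V rule: finite_induct) (simp_all add: mvar_power mult_single)

lemma single_one_inject:
  "Poly_Mapping.single t (1::'k::zero_neq_one) = Poly_Mapping.single u 1 \<longleftrightarrow> t = u"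
  by (metis lookup_single_eq lookup_single_not_eq zero_neq_one)

lemma lookup_sum_single:
  assumes "finite V"
  shows "Poly_Mapping.lookup (\<Sum>x\<in>V. Poly_Mapping.single x (f x)) y = (if y \<in> V then f y else 0)"
  using assms by (simp add: lookup_sum lookup_single when_def)

theorem proposition4p3:
  fixes G :: "nat ugraph" and m s :: nat and \<alpha> :: "nat \<Rightarrow> nat"
    and I :: "(nat, 'k::field) mpoly set"
    and I\<alpha> :: "(nat \<times> nat, 'k) mpoly set"
  assumes "simple_graph G" and "verts G = {1..m}"
    and "\<forall>i\<in>{1..m}. \<alpha> i > 0"
    and "s \<ge> 1"
    and "I = edge_ideal G"
    and "I\<alpha> = edge_ideal (parallelization G \<alpha>)"
  shows "min_monomial_gens (verts (parallelization G \<alpha>))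
           (symbolic_power (poly_ring (verts (parallelization G \<alpha>))) I\<alpha> s) =
         {(\<Prod>i=1..m. \<Prod>j=1..\<alpha> i. mvar (i, j) ^ e i j) | e :: nat \<Rightarrow> nat \<Rightarrow> nat.
            \<exists>a :: nat \<Rightarrow> nat.
              (\<Prod>i=1..m. mvar i ^ a i)
                \<in> min_monomial_gens (verts G) (symbolic_power (poly_ring (verts G)) I s)
              \<and> (\<forall>i\<in>{1..m}. (\<Sum>j=1..\<alpha> i. e i j) = a i)}"
proof -
  let ?W = "verts (parallelization G \<alpha>)"
  let ?M = "min_exps (symbolic_exps G s)"
  define ex where "ex a = (\<Sum>i=1..m. Poly_Mapping.single i (a i))" for a :: "nat \<Rightarrow> nat"
  define ex' where "ex' e = (\<Sum>p\<in>?W. Poly_Mapping.single p (e (fst p) (snd p)))"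
    for e :: "nat \<Rightarrow> nat \<Rightarrow> nat"
  have W: "?W = (SIGMA i:{1..m}. {1..\<alpha> i})" "finite ?W"
    by (simp_all add: verts_parallelization assms(2))
  have lookup_ex: "Poly_Mapping.lookup (ex a) i = (if i \<in> {1..m} then a i else 0)" for a i
    unfolding ex_def by (rule lookup_sum_single) simp
  have lookup_ex': "Poly_Mapping.lookup (ex' e) p = (if p \<in> ?W then e (fst p) (snd p) else 0)" for e p
    unfolding ex'_def by (rule lookup_sum_single[OF W(2)])
  have ex'_in: "ex' e \<in> exps ?W" for e
    by (auto simp: exps_def in_keys_iff lookup_ex' split: if_splits)
  have ex'_surj: "\<exists>e. t = ex' e" if t: "t \<in> exps ?W" for t
  proof
    show "t = ex' (\<lambda>i j. Poly_Mapping.lookup t (i, j))"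
      using t by (intro poly_mapping_eqI) (auto simp: lookup_ex' exps_def in_keys_iff)
  qed
  have collapse: "collapse ?W (ex' e) = ex a \<longleftrightarrow> (\<forall>i\<in>{1..m}. (\<Sum>j=1..\<alpha> i. e i j) = a i)" for e a
  proof -
    have sum: "Poly_Mapping.lookup (collapse ?W (ex' e)) i
        = (if i \<in> {1..m} then \<Sum>j=1..\<alpha> i. e i j else 0)" for i
    proof -
      have *: "{p \<in> ?W. fst p = i} = (if i \<in> {1..m} then Pair i ` {1..\<alpha> i} else {})"
        unfolding W(1) by auto
      show ?thesis
        unfolding lookup_collapse[OF W(2)] weight_def *
        by (auto simp: sum.reindex inj_on_def lookup_ex' W(1))
    qed
    show ?thesis
      unfolding poly_mapping_eq_iff fun_eq_iff sum lookup_ex by auto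
  qed
  have collapse_surj: "\<exists>a. collapse ?W (ex' e) = ex a" for e
    using collapse[of e "\<lambda>i. \<Sum>j=1..\<alpha> i. e i j"] by blast
  have gens: "min_monomial_gens (verts G) (symbolic_power (poly_ring (verts G)) I s)
      = (\<lambda>t. Poly_Mapping.single t (1::'k)) ` ?M"
    unfolding assms(5) by (rule min_monomial_gens_symbolic_power[OF assms(1)])
  have mon: "(\<Prod>i=1..m. mvar i ^ a i :: (nat, 'k) mpoly) = Poly_Mapping.single (ex a) 1" for a
    by (simp add: prod_mvar_power ex_def)
  have mon': "(\<Prod>i=1..m. \<Prod>j=1..\<alpha> i. mvar (i, j) ^ e i j :: (nat \<times> nat, 'k) mpoly)
      = Poly_Mapping.single (ex' e) 1" for e
    using prod_mvar_power[OF W(2), of "\<lambda>p. e (fst p) (snd p)"]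
    by (simp add: ex'_def W(1) prod.Sigma split_def)
  have "min_monomial_gens ?W (symbolic_power (poly_ring ?W) I\<alpha> s)
      = (\<lambda>t. Poly_Mapping.single t (1::'k)) ` min_exps (symbolic_exps (parallelization G \<alpha>) s)"
    unfolding assms(6)
    by (rule min_monomial_gens_symbolic_power[OF simple_graph_parallelization[OF assms(1)]])
  also have "min_exps (symbolic_exps (parallelization G \<alpha>) s)
      = {ex' e | e. \<exists>a. ex a \<in> ?M \<and> collapse ?W (ex' e) = ex a}" (is "_ = ?E")
  proof (rule Set.set_eqI)
    fix t
    show "t \<in> min_exps (symbolic_exps (parallelization G \<alpha>) s) \<longleftrightarrow> t \<in> ?E"
      unfolding min_exps_parallelization[OF assms(1)]
      using ex'_in ex'_surj[of t] collapse_surj by force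
  qed
  finally show ?thesis
    unfolding gens mon mon' collapse by (auto simp: image_iff single_one_inject)
qed

end
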